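(* Let $V$ be a vector space over a field and let $W$ be a subspace of $V$. The semigroup $\overline{L}(V,W)$ is semi-balanced if and only if $V$ is finite-dimensional.
   Context: Maps are written on the right. $L(V)$ is the semigroup of all linear maps $V\to V$ under composition, and $\overline{L}(V,W)=\{f\in L(V): Wf\subseteq W\}$, regarded as a subsemigroup of the semigroup $T(V)$ of all maps $V\to V$. For $f\in T(V)$, the kernel $\ker(f)=\{(x,y)\in V\times V: xf=yf\}$ is an equivalence relation on $V$; a transversal of it is a subset of $V$ containing exactly one element of each class. The collapse $\mathrm{c}(f)$ is the cardinality of the set $V\setminus T_f$, where $T_f$ is any transversal of $\ker(f)$ (the cardinality does not depend on the choice), and the defect $\mathrm{d}(f)$ is the cardinality of the set $V\setminus Vf$. The map $f$ is semi-balanced if $\mathrm{c}(f)=\mathrm{d}(f)$ (as cardinals). A subsemigroup of $T(V)$ is semi-balanced if all its elements are semi-balanced. *)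

theory Defs
  imports Complex_Main
begin

unbundle cardinal_syntax

text \<open>
  The vector space V is the whole carrier type \<open>'v\<close>, so T(V) is the type \<open>'v \<Rightarrow> 'v\<close>.
  Maps written on the right become ordinary application: \<open>x f\<close> is \<open>f x\<close>, \<open>V f\<close> is \<open>range f\<close>,
  and the product \<open>f g\<close> is \<open>g \<circ> f\<close>.
\<close>

definition kernel :: "('v \<Rightarrow> 'v) \<Rightarrow> ('v \<times> 'v) set" where
  "kernel f = {(x, y). f x = f y}"

definition transversal :: "('v \<times> 'v) set \<Rightarrow> 'v set \<Rightarrow> bool" where
  "transversal r T \<longleftrightarrow> (\<forall>C \<in> UNIV // r. \<exists>!x. x \<in> C \<inter> T)"

text \<open>
  Cardinals are Isabelle's cardinal orders \<open>|A|\<close>, with \<open>=o\<close> as equality of cardinals (unlike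
  \<open>card\<close>, these distinguish infinite cardinalities). The choice of the transversal in \<open>collapse\<close>
  is immaterial by \<open>collapse_eq\<close> below.
\<close>

definition collapse :: "('v \<Rightarrow> 'v) \<Rightarrow> 'v rel" where
  "collapse f = |UNIV - (SOME T. transversal (kernel f) T)|"

definition defect :: "('v \<Rightarrow> 'v) \<Rightarrow> 'v rel" where
  "defect f = |UNIV - range f|"

definition semi_balanced :: "('v \<Rightarrow> 'v) \<Rightarrow> bool" where
  "semi_balanced f \<longleftrightarrow> collapse f =o defect f"

definition subsemigroup_T :: "('v \<Rightarrow> 'v) set \<Rightarrow> bool" where
  "subsemigroup_T S \<longleftrightarrow> S \<noteq> {} \<and> (\<forall>f\<in>S. \<forall>g\<in>S. g \<circ> f \<in> S)"

definition semi_balanced_semigroup :: "('v \<Rightarrow> 'v) set \<Rightarrow> bool" where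
  "semi_balanced_semigroup S \<longleftrightarrow> subsemigroup_T S \<and> (\<forall>f\<in>S. semi_balanced f)"

definition L_bar ::
    "('k::field \<Rightarrow> 'v::ab_group_add \<Rightarrow> 'v) \<Rightarrow> 'v set \<Rightarrow> ('v \<Rightarrow> 'v) set" where
  "L_bar scale W = {f. Vector_Spaces.linear scale scale f \<and> f ` W \<subseteq> W}"

lemma equiv_kernel: "equiv UNIV (kernel f)"
  by (auto simp: kernel_def equiv_def refl_on_def sym_def trans_def)

lemma transversal_kernel_iff:
  "transversal (kernel f) T \<longleftrightarrow> (\<forall>y. \<exists>!x. x \<in> T \<and> f x = f y)"
proof -
  have "UNIV // kernel f = range (\<lambda>y. {x. f x = f y})"
    by (auto simp: quotient_def kernel_def Image_def eq_commute)
  then show ?thesis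
    by (simp add: transversal_def conj_commute)
qed

lemma transversal_kernel_exists: "\<exists>T. transversal (kernel f) T"
proof
  let ?g = "\<lambda>x. SOME z. f z = f x"
  have g: "f (?g x) = f x" for x
    by (rule someI[of _ x]) simp
  show "transversal (kernel f) (range ?g)"
    unfolding transversal_kernel_iff
  proof
    fix y
    show "\<exists>!x. x \<in> range ?g \<and> f x = f y"
    proof (rule ex1I[of _ "?g y"])
      show "?g y \<in> range ?g \<and> f (?g y) = f y"
        using g by blast
    next
      fix x
      assume x: "x \<in> range ?g \<and> f x = f y"
      then obtain w where w: "x = ?g w" by blast
      have "f w = f y" using x g[of w] w by simp
      then show "x = ?g y" using w by simp
    qed
  qed
qed

lemma transversal_complement_card_of:
  assumes "transversal (kernel f) T" "transversal (kernel f) U"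
  shows "|UNIV - T| =o |UNIV - U|"
proof -
  have ex: "\<forall>y. \<exists>x. x \<in> T \<and> f x = f y" "\<forall>y. \<exists>x. x \<in> U \<and> f x = f y"
    and uT: "\<And>x y. x \<in> T \<Longrightarrow> y \<in> T \<Longrightarrow> f x = f y \<Longrightarrow> x = y"
    and uU: "\<And>x y. x \<in> U \<Longrightarrow> y \<in> U \<Longrightarrow> f x = f y \<Longrightarrow> x = y"
    using assms unfolding transversal_kernel_iff by metis+
  obtain t where t: "\<And>y. t y \<in> T" "\<And>y. f (t y) = f y" using ex(1) by metis
  obtain u where u: "\<And>y. u y \<in> U" "\<And>y. f (u y) = f y" using ex(2) by metis
  have "bij_betw (\<lambda>x. if x \<in> U then t x else x) (UNIV - T) (UNIV - U)"
  proof (rule bij_betw_byWitness[where f' = "\<lambda>x. if x \<in> T then u x else x"])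
    show "\<forall>x\<in>UNIV - T. (\<lambda>x. if x \<in> T then u x else x) (if x \<in> U then t x else x) = x"
      using t u uU by auto
    show "\<forall>x\<in>UNIV - U. (\<lambda>x. if x \<in> U then t x else x) (if x \<in> T then u x else x) = x"
      using t u uT by auto
    show "(\<lambda>x. if x \<in> U then t x else x) ` (UNIV - T) \<subseteq> UNIV - U"
      using t uU by (auto split: if_splits) (metis t)
    show "(\<lambda>x. if x \<in> T then u x else x) ` (UNIV - U) \<subseteq> UNIV - T"
      using u uT by (auto split: if_splits) (metis u)
  qed
  then show ?thesis
    using card_of_ordIso by blast
qed

lemma collapse_eq:
  assumes "transversal (kernel f) T"
  shows "|UNIV - T| =o collapse f"
  unfolding collapse_def
  using assms someI_ex[OF transversal_kernel_exists] by (rule transversal_complement_card_of)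

lemma subsemigroup_L_bar:
  assumes "vector_space scale"
  shows "subsemigroup_T (L_bar scale W)"
proof -
  interpret vector_space scale by fact
  have "id \<in> L_bar scale W"
    using linear_id by (simp add: L_bar_def)
  moreover have "g \<circ> f \<in> L_bar scale W" if "f \<in> L_bar scale W" "g \<in> L_bar scale W" for f g
    using that by (auto simp: L_bar_def intro: Vector_Spaces.linear_compose)
  ultimately show ?thesis
    by (auto simp: subsemigroup_T_def)
qed

end

theory Submission
  imports Defs
begin

text \<open>
  An injective linear self-map of a finite-dimensional space is bijective. If \<open>f\<close> is linear and not
  injective, then translation by a nonzero element of its null space moves a transversal of
  \<open>ker f\<close> into its own complement, and translation by a vector outside the range moves the range
  into its own complement. So if \<open>V\<close> is infinite, both complements have the cardinality of \<open>V\<close>;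
  if \<open>V\<close> is finite, the claim is a count, as \<open>f\<close> maps a transversal bijectively onto its range.
  Conversely, if \<open>V\<close> is infinite-dimensional, then a basis of \<open>V\<close> extending a basis of \<open>W\<close> has an
  infinite part inside or outside \<open>W\<close>, and a shift of that part extends to an injective,
  non-surjective map that preserves \<open>W\<close>.
\<close>

lemma transversal_kernel_bij_betw:
  assumes "transversal (kernel f) T"
  shows "bij_betw f T (range f)"
  unfolding bij_betw_def
proof
  show "inj_on f T"
    using assms unfolding transversal_kernel_iff by (metis inj_onI)
  show "f ` T = range f"
    using assms unfolding transversal_kernel_iff by (auto simp: image_iff) metis
qed

lemma collapse_eq_card_of_Diff:
  assumes "transversal (kernel f) T"
  shows "collapse f =o |UNIV - T|"
  using collapse_eq[OF assms] by (rule ordIso_symmetric)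

lemma semi_balancedI:
  assumes "transversal (kernel f) T" and "|UNIV - T| =o |UNIV - range f|"
  shows "semi_balanced f"
  unfolding semi_balanced_def defect_def
  using collapse_eq_card_of_Diff[OF assms(1)] assms(2) by (rule ordIso_transitive)

lemma transversal_kernel_inj: "inj f \<Longrightarrow> transversal (kernel f) UNIV"
  unfolding transversal_kernel_iff by (auto dest: injD)

text \<open>The kernel classes of an injective map are singletons, so the whole space is a
  transversal and the collapse is zero. Equality with the defect then says that nothing lies outside
  the range.\<close>

lemma semi_balanced_inj_iff:
  assumes "inj f"
  shows "semi_balanced f \<longleftrightarrow> surj f"
proof
  assume "semi_balanced f"
  then have "|UNIV - UNIV :: 'a set| =o |UNIV - range f|"
    unfolding semi_balanced_def defect_def
    using collapse_eq[OF transversal_kernel_inj[OF assms]] ordIso_transitive by blast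
  then have "UNIV - range f = {}"
    using card_of_empty3 ordIso_iff_ordLeq by fastforce
  then show "surj f"
    by blast
next
  assume "surj f"
  then show "semi_balanced f"
    using semi_balancedI[OF transversal_kernel_inj[OF assms]] card_of_refl by metis
qed

lemma semi_balanced_finite:
  fixes f :: "'a \<Rightarrow> 'a"
  assumes "finite (UNIV :: 'a set)"
  shows "semi_balanced f"
proof -
  obtain T where T: "transversal (kernel f) T"
    using transversal_kernel_exists by blast
  have fin: "finite A" for A :: "'a set"
    using assms by (rule rev_finite_subset) simp
  have "card T = card (range f)"
    using transversal_kernel_bij_betw[OF T] by (rule bij_betw_same_card)
  then have "card (UNIV - T) = card (UNIV - range f)"
    by (simp add: card_Diff_subset fin)
  then have "|UNIV - T| =o |UNIV - range f|"
    by (simp add: finite_same_card_bij card_of_ordIso[symmetric] fin)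
  with T show ?thesis
    by (rule semi_balancedI)
qed

text \<open>The injection \<open>g\<close> shows that the complement is at least as large as
  \<open>A\<close>. Hence the complement is infinite and absorbs \<open>A\<close> in the cardinal
  sum.\<close>

lemma card_of_Compl_infinite:
  fixes A :: "'a set"
  assumes "infinite (UNIV :: 'a set)" and "inj_on g A" and "g ` A \<subseteq> UNIV - A"
  shows "|UNIV - A| =o |UNIV :: 'a set|"
proof -
  have le: "|A| \<le>o |UNIV - A|"
    using assms(2,3) card_of_ordLeq by blast
  have "infinite (UNIV - A)"
  proof
    assume "finite (UNIV - A)"
    moreover from this have "finite A"
      using le card_of_ordLeq_finite by blast
    ultimately show False
      using assms(1) by (metis finite_Diff2)
  qed
  then have "|A \<union> (UNIV - A)| \<le>o |UNIV - A|"
    using le card_of_Un_Plus_ordLeq card_of_Plus_infinite2 ordLeq_ordIso_trans by blast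
  then show ?thesis
    by (simp add: ordIso_iff_ordLeq card_of_mono1)
qed

context vector_space
begin

text \<open>Applied to the range of a non-surjective linear map, this computes the defect.\<close>

lemma card_of_Compl_subspace:
  assumes "infinite (UNIV :: 'b set)" and "subspace S" and "S \<noteq> UNIV"
  shows "|UNIV - S| =o |UNIV :: 'b set|"
proof -
  obtain v where v: "v \<notin> S"
    using assms(3) by blast
  have "v + x \<notin> S" if "x \<in> S" for x
    using subspace_diff[OF assms(2) _ that, of "v + x"] v by auto
  then show ?thesis
    by (intro card_of_Compl_infinite[OF assms(1), of "\<lambda>x. v + x"]) auto
qed

lemma card_of_Compl_transversal:
  assumes "infinite (UNIV :: 'b set)" and "Vector_Spaces.linear scale scale f" and "\<not> inj f"
    and "transversal (kernel f) T"
  shows "|UNIV - T| =o |UNIV :: 'b set|"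
proof -
  interpret f: Vector_Spaces.linear scale scale f by fact
  obtain k where k: "f k = 0" "k \<noteq> 0"
    using assms(3) f.inj_iff_eq_0 by blast
  \<comment> \<open>Since \<open>k\<close> is in the null space, \<open>x\<close> and
    \<open>k + x\<close> lie in the same kernel class, of which \<open>T\<close> contains only one
    element.\<close>
  have "k + x \<notin> T" if "x \<in> T" for x
  proof
    assume "k + x \<in> T"
    moreover have "f (k + x) = f x"
      by (simp add: f.add k(1))
    ultimately have "k + x = x"
      using assms(4) that unfolding transversal_kernel_iff by metis
    with k(2) show False
      by simp
  qed
  then show ?thesis
    by (intro card_of_Compl_infinite[OF assms(1), of "\<lambda>x. k + x"]) auto
qed

lemma ex_inj_not_surj_in_L_bar:
  assumes W: "subspace W" and inf: "\<And>B. independent B \<Longrightarrow> span B = UNIV \<Longrightarrow> infinite B"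
  shows "\<exists>f \<in> L_bar scale W. inj f \<and> \<not> surj f"
proof -
  obtain BW where BW: "BW \<subseteq> W" "independent BW" "W \<subseteq> span BW"
    using maximal_independent_subset by blast
  define B where "B = extend_basis BW"
  have B: "BW \<subseteq> B" "independent B" "span B = UNIV"
    using BW(2) by (simp_all add: B_def extend_basis_superset independent_extend_basis)
  \<comment> \<open>The infinite basis \<open>B\<close> splits into two parts, one of which is
    infinite. Moving vectors only within that part keeps both parts invariant.\<close>
  obtain S where S: "infinite S" "S = BW \<or> S = B - BW"
    using inf[OF B(2,3)] B(1) by (metis finite_Diff2)
  then obtain a where a: "a \<in> S"
    using infinite_imp_nonempty by blast
  \<comment> \<open>The shift of Hilbert's hotel: \<open>h\<close> injects \<open>S\<close> into
    itself and misses exactly \<open>a\<close>.\<close>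
  obtain h where h: "bij_betw h S (S - {a})"
    using infinite_imp_bij_betw[OF S(1)] by blast
  define g where "g x = (if x \<in> S then h x else x)" for x
  have hS: "h x \<in> S - {a}" if "x \<in> S" for x
    using h that by (auto simp: bij_betw_def)
  have SB: "S \<subseteq> B"
    using S(2) B(1) by blast
  have inj_g: "inj_on g B"
    using h hS by (auto simp: inj_on_def g_def bij_betw_def split: if_splits)
  have gB: "g ` B \<subseteq> B - {a}"
    using hS SB a by (auto simp: g_def)
  \<comment> \<open>If \<open>S = BW\<close>, then \<open>h\<close> stays inside \<open>BW\<close>;
    otherwise \<open>g\<close> is the identity on \<open>BW\<close>.\<close>
  have gBW: "g ` BW \<subseteq> BW"
    using hS S(2) by (auto simp: g_def)
  interpret vector_space_pair scale scale ..
  define f where "f = construct B g"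
  interpret f: Vector_Spaces.linear scale scale f
    unfolding f_def using B(2) by (rule linear_construct)
  have fg: "f x = g x" if "x \<in> B" for x
    unfolding f_def using B(2) that by (rule construct_basis)
  have fB: "f ` B = g ` B"
    using fg by simp
  \<comment> \<open>The image of the basis is again a subset of the basis, hence independent;
    together with injectivity on \<open>B\<close> this makes \<open>f\<close> injective on the
    span.\<close>
  have "independent (f ` B)"
    unfolding fB using B(2) gB by (meson Diff_subset independent_mono order_trans)
  moreover have "inj_on f B"
    using inj_g fg by (simp cong: inj_on_cong)
  ultimately have "inj f"
    using f.inj_on_span_independent_image B(3) by metis
  moreover have "f ` W \<subseteq> W"
  proof -
    have "f ` BW \<subseteq> W"
      using fg gBW B(1) BW(1) by fastforce
    then have "f ` span BW \<subseteq> W"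
      unfolding f.span_image[symmetric] using W by (rule span_minimal)
    with BW(3) show ?thesis
      by blast
  qed
  moreover have "\<not> surj f"
  proof
    assume "surj f"
    then have "a \<in> span (g ` B)"
      using f.span_image[of B] fB B(3) by simp
    then have "a \<in> span (B - {a})"
      using span_mono[OF gB] by blast
    then show False
      using B(2) a SB unfolding dependent_def by blast
  qed
  ultimately show ?thesis
    using f.linear_axioms by (auto simp: L_bar_def)
qed

end

lemma (in finite_dimensional_vector_space) semi_balanced_linear:
  assumes "Vector_Spaces.linear scale scale f"
  shows "semi_balanced f"
proof (cases "inj f")
  case True
  then show ?thesis
    using semi_balanced_inj_iff linear_inj_imp_surj[OF assms] by blast
next
  case False
  interpret f: Vector_Spaces.linear scale scale f by fact
  \<comment> \<open>Over a finite field the space has only finitely many vectors. Cardinal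
    absorption then fails, so this case is settled by counting.\<close>
  show ?thesis
  proof (cases "finite (UNIV :: 'b set)")
    case True
    then show ?thesis
      by (rule semi_balanced_finite)
  next
    case inf: False
    obtain T where T: "transversal (kernel f) T"
      using transversal_kernel_exists by blast
    \<comment> \<open>Finite dimension enters here: a surjective linear self-map would be
      injective.\<close>
    have "range f \<noteq> UNIV"
      using False linear_surj_imp_inj[OF assms] by blast
    then have "|UNIV - range f| =o |UNIV :: 'b set|"
      using inf f.subspace_image[OF subspace_UNIV] by (intro card_of_Compl_subspace)
    then have "|UNIV - T| =o |UNIV - range f|"
      using card_of_Compl_transversal[OF inf assms False T] ordIso_symmetric ordIso_transitive
      by blast
    with T show ?thesis
      by (rule semi_balancedI)
  qed
qed

theorem theorem5p11:
  fixes scale :: "'k::field \<Rightarrow> 'v::ab_group_add \<Rightarrow> 'v"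
    and W :: "'v set"
  assumes "vector_space scale"
    and "module.subspace scale W"
  shows "semi_balanced_semigroup (L_bar scale W) \<longleftrightarrow>
    (\<exists>B. finite_dimensional_vector_space scale B)"
proof
  interpret vector_space scale by fact
  assume sb: "semi_balanced_semigroup (L_bar scale W)"
  show "\<exists>B. finite_dimensional_vector_space scale B"
  proof (rule ccontr)
    assume "\<nexists>B. finite_dimensional_vector_space scale B"
    \<comment> \<open>The locale asserts that \<open>B\<close> is a finite basis, so its failure for
      every \<open>B\<close> means that all bases are infinite.\<close>
    then have "infinite B" if "independent B" "span B = UNIV" for B
      using that vector_space_axioms
      by (auto simp: finite_dimensional_vector_space_def finite_dimensional_vector_space_axioms_def)
    then obtain f where "f \<in> L_bar scale W" "inj f" "\<not> surj f"
      using ex_inj_not_surj_in_L_bar[OF assms(2)] by blast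
    with sb show False
      by (auto simp: semi_balanced_semigroup_def semi_balanced_inj_iff)
  qed
next
  assume "\<exists>B. finite_dimensional_vector_space scale B"
  then obtain B where "finite_dimensional_vector_space scale B" ..
  then have "semi_balanced f" if "f \<in> L_bar scale W" for f
    using that by (auto simp: L_bar_def finite_dimensional_vector_space.semi_balanced_linear)
  with subsemigroup_L_bar[OF assms(1)] show "semi_balanced_semigroup (L_bar scale W)"
    by (simp add: semi_balanced_semigroup_def)
qed

end
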